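(* There exists a deterministic congested clique algorithm that, given an Eulerian graph $G=(V,E)$ on $n$ vertices, finds a Eulerian orientation of $G$ in $O(\log n\log^* n)$ rounds.
   Context: Congested clique model: there are $n$ processors (nodes), one per vertex of the input graph, each with a unique $O(\log n)$-bit identifier; computation proceeds in synchronous rounds, and in each round every node may send a (possibly different) message of $O(\log n)$ bits to every other node. Initially each node knows only its incident edges; complexity is the number of rounds. An undirected graph is Eulerian if every vertex has even degree. A Eulerian orientation is an orientation of every edge such that at each vertex the number of edges entering equals the number of edges leaving. $\log^*$ is the iterated logarithm. *)

theory Defs
  imports Complex_Main "HOL-Library.Landau_Symbols"
begin

section \<open>Eulerian graphs and Eulerian orientations\<close>

text \<open>Simple graphs. A vertex is represented by the identifier of its processor, so the vertex
  set is a finite set of naturals that is not assumed to be an initial segment.\<close>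

definition simple_graph :: "nat set \<Rightarrow> nat set set \<Rightarrow> bool" where
  "simple_graph V E \<longleftrightarrow> finite V \<and> (\<forall>e\<in>E. e \<subseteq> V \<and> card e = 2)"

definition incident_edges :: "nat set set \<Rightarrow> nat \<Rightarrow> nat set set" where
  "incident_edges E v = {e \<in> E. v \<in> e}"

definition eulerian_graph :: "nat set \<Rightarrow> nat set set \<Rightarrow> bool" where
  "eulerian_graph V E \<longleftrightarrow> simple_graph V E \<and> (\<forall>v\<in>V. even (card (incident_edges E v)))"

text \<open>The pair \<open>(a, b)\<close> is the edge \<open>{a, b}\<close> directed from \<open>a\<close> to \<open>b\<close>. Bijectivity says that every
  edge receives exactly one of its two directions and that there are no other arcs.\<close>

definition orientation :: "nat set set \<Rightarrow> (nat \<times> nat) set \<Rightarrow> bool" where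
  "orientation E D \<longleftrightarrow> bij_betw (\<lambda>(a, b). {a, b}) D E"

definition eulerian_orientation :: "nat set \<Rightarrow> nat set set \<Rightarrow> (nat \<times> nat) set \<Rightarrow> bool" where
  "eulerian_orientation V E D \<longleftrightarrow>
     orientation E D \<and> (\<forall>v\<in>V. card {a \<in> D. snd a = v} = card {a \<in> D. fst a = v})"

definition incident_arcs :: "(nat \<times> nat) set \<Rightarrow> nat \<Rightarrow> (nat \<times> nat) set" where
  "incident_arcs D v = {a \<in> D. fst a = v \<or> snd a = v}"


section \<open>The congested clique\<close>

text \<open>Local computation and local memory are unrestricted, so the state of a node is everything it
  has learned so far: the number of nodes, its own identifier, its incident edges, and the messages
  received in each round (oldest round first). An inbox maps the identifier of a sender to the
  message received from it, if any.\<close>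

type_synonym message = "bool list"

record knowledge =
  num_nodes :: nat
  own_id :: nat
  own_edges :: "nat set set"
  inboxes :: "(nat \<Rightarrow> message option) list"

text \<open>A deterministic algorithm is the code run by every node: the message (if any) it sends
  to the node with a given identifier in the next round, and the output it computes at the end.
  Initially a node need not know which identifiers are in use; a message to an identifier that
  belongs to no other node is not delivered.\<close>

record 'o cc_algorithm =
  send :: "knowledge \<Rightarrow> nat \<Rightarrow> message option"
  result :: "knowledge \<Rightarrow> 'o"

primrec cc_run :: "'o cc_algorithm \<Rightarrow> nat set \<Rightarrow> nat set set \<Rightarrow> nat \<Rightarrow> nat \<Rightarrow> knowledge" where
  "cc_run A V E 0 v =
     \<lparr>num_nodes = card V, own_id = v, own_edges = incident_edges E v, inboxes = []\<rparr>"
| "cc_run A V E (Suc t) v =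
     (cc_run A V E t v)\<lparr>inboxes := inboxes (cc_run A V E t v) @
        [\<lambda>u. if u \<in> V \<and> u \<noteq> v then send A (cc_run A V E t u) v else None]\<rparr>"

text \<open>In the first \<open>T\<close> rounds, every message has at most \<open>b * log 2 n\<close> bits.\<close>

definition respects_bandwidth ::
    "'o cc_algorithm \<Rightarrow> nat \<Rightarrow> nat set \<Rightarrow> nat set set \<Rightarrow> nat \<Rightarrow> bool" where
  "respects_bandwidth A b V E T \<longleftrightarrow>
     (\<forall>t<T. \<forall>u\<in>V. \<forall>v\<in>V. \<forall>m. u \<noteq> v \<longrightarrow> send A (cc_run A V E t u) v = Some m \<longrightarrow>
        real (length m) \<le> real b * log 2 (real (card V)))"

text \<open>Identifiers of \<open>c * log 2 n\<close> bits, i.e. naturals below \<open>n ^ c\<close>. Their uniqueness is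
  built into the identification of vertices with identifiers.\<close>

definition short_ids :: "nat \<Rightarrow> nat set \<Rightarrow> bool" where
  "short_ids c V \<longleftrightarrow> (\<forall>v\<in>V. v < card V ^ c)"


section \<open>The iterated logarithm\<close>

definition log_star :: "real \<Rightarrow> nat" where
  "log_star x = (LEAST k. (log 2 ^^ k) x \<le> 1)"

end

theory Submission
  imports Defs
begin

text \<open>Merge the edges along a binary tree whose leaves are the nodes. Each group of nodes keeps a set
  of edges that contains no nonempty subset of even degrees; such a set has at most \<open>n\<close> edges, because
  its subsets are distinguished by their vertices of odd degree. Hence a group passes its whole edge
  set on to the sibling group in two rounds, one edge through each of the \<open>n\<close> nodes. All members of
  the united group then orient the same maximal even part of the union, locally, and keep the rest.
  At the root the rest has even degrees, so it is empty. The tree has \<open>O(log n)\<close> levels, so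
  the factor \<open>log* n\<close> is not even needed. Since every member follows the merging of its group, each
  node learns the orientation of the edges it owns, and one last round informs the other
  endpoints.\<close>

section \<open>Edge sets of even degree\<close>

text \<open>Among finite edge sets these form the cycle space over the two-element field, with
  symmetric difference as addition. Ranging over all naturals saves a vertex-set parameter, since a
  vertex on no edge has degree 0.\<close>

definition even_degrees :: "nat set set \<Rightarrow> bool" where
  "even_degrees X \<longleftrightarrow> (\<forall>v. even (card (incident_edges X v)))"

abbreviation balanced_orientation :: "nat set set \<Rightarrow> (nat \<times> nat) set \<Rightarrow> bool" where
  "balanced_orientation \<equiv> eulerian_orientation UNIV"

lemma simple_graph_finite: "simple_graph V X \<Longrightarrow> finite X"
  unfolding simple_graph_def by (meson PowI finite_Pow_iff finite_subset subsetI)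

lemma simple_graph_subset: "simple_graph V X \<Longrightarrow> Y \<subseteq> X \<Longrightarrow> simple_graph V Y"
  unfolding simple_graph_def by blast

lemma even_card_sym_diff:
  assumes "finite A" "finite B"
  shows "even (card (sym_diff A B)) \<longleftrightarrow> (even (card A) \<longleftrightarrow> even (card B))"
proof -
  have "card (sym_diff A B) = card (A - B) + card (B - A)"
    using assms by (intro card_Un_disjoint) auto
  moreover have "card A = card (A - B) + card (A \<inter> B)"
    using assms by (subst card_Un_disjoint[symmetric]) (auto intro: arg_cong[where f = card])
  moreover have "card B = card (B - A) + card (A \<inter> B)"
    using assms by (subst card_Un_disjoint[symmetric]) (auto intro: arg_cong[where f = card])
  ultimately show ?thesis by auto
qed

lemma even_incident_sym_diff:
  assumes "finite X" "finite Y"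
  shows "even (card (incident_edges (sym_diff X Y) v)) \<longleftrightarrow>
    (even (card (incident_edges X v)) \<longleftrightarrow> even (card (incident_edges Y v)))"
proof -
  have "incident_edges (sym_diff X Y) v = sym_diff (incident_edges X v) (incident_edges Y v)"
    by (auto simp: incident_edges_def)
  then show ?thesis
    using assms by (simp add: even_card_sym_diff incident_edges_def)
qed

lemma even_degrees_sym_diff:
  assumes "finite X" "finite Y" "even_degrees X" "even_degrees Y"
  shows "even_degrees (sym_diff X Y)"
  using assms by (simp add: even_degrees_def even_incident_sym_diff)

lemma even_degrees_triangle:
  assumes "a \<noteq> b" "a \<noteq> v" "b \<noteq> v"
  shows "even_degrees {{v, a}, {v, b}, {a, b}}"
  unfolding even_degrees_def
proof
  fix x
  have "incident_edges {{v, a}, {v, b}, {a, b}} x =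
    (if x = v then {{v, a}, {v, b}} else if x = a then {{v, a}, {a, b}}
     else if x = b then {{v, b}, {a, b}} else {})"
    using assms by (auto simp: incident_edges_def)
  then show "even (card (incident_edges {{v, a}, {v, b}, {a, b}} x))"
    using assms by (auto simp: card_insert_if doubleton_eq_iff)
qed

text \<open>Rewrites balance as vanishing net flow, a sum over arcs, so that uniting and replacing
  arc sets becomes additive.\<close>

lemma balance_iff_sum:
  assumes "finite D"
  shows "card {a \<in> D. snd a = v} = card {a \<in> D. fst a = v} \<longleftrightarrow>
    (\<Sum>a\<in>D. of_bool (snd a = v) - of_bool (fst a = v) :: int) = 0"
proof -
  have "int (card {a \<in> D. P a}) = (\<Sum>a\<in>D. of_bool (P a))" for P
    using assms by (simp add: Int_def)
  then show ?thesis
    by (simp add: sum_subtractf del: sum_of_bool_eq flip: of_nat_eq_iff[where 'a = int])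
qed

section \<open>Building balanced orientations from smaller ones\<close>

lemma orientation_finite: "orientation X D \<Longrightarrow> finite X \<Longrightarrow> finite D"
  unfolding orientation_def using bij_betw_finite by blast

lemma orientation_edge: "orientation X D \<Longrightarrow> (a, b) \<in> D \<Longrightarrow> {a, b} \<in> X"
  unfolding orientation_def by (auto dest: bij_betw_apply)

lemma orientation_cases:
  assumes "orientation X D" "{a, b} \<in> X"
  shows "(a, b) \<in> D \<or> (b, a) \<in> D"
proof -
  have "{a, b} \<in> (\<lambda>(a, b). {a, b}) ` D"
    using assms by (simp add: orientation_def bij_betw_def)
  then obtain x y where "(x, y) \<in> D" "{a, b} = {x, y}"
    by (elim imageE) (simp split: prod.splits)
  then show ?thesis by (metis doubleton_eq_iff)
qed

lemma orientation_asym: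
  assumes "orientation X D" "(a, b) \<in> D" "a \<noteq> b"
  shows "(b, a) \<notin> D"
proof
  assume "(b, a) \<in> D"
  with assms(1,2) have "(a, b) = (b, a)"
    unfolding orientation_def bij_betw_def
    by (intro inj_onD[of "\<lambda>(a, b). {a, b}" D]) (simp_all add: insert_commute)
  with assms(3) show False by simp
qed

text \<open>Net flow adds up over disjoint arc sets, and disjoint edge sets have disjoint arc sets
  because an arc determines its edge.\<close>

lemma balanced_orientation_Un:
  assumes "balanced_orientation X D" "balanced_orientation X' D'" "X \<inter> X' = {}"
    and "finite X" "finite X'"
  shows "balanced_orientation (X \<union> X') (D \<union> D')"
proof -
  have o: "orientation X D" "orientation X' D'"
    using assms by (auto simp: eulerian_orientation_def)
  have fin: "finite D" "finite D'"
    using o assms orientation_finite by blast+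
  have disj: "D \<inter> D' = {}"
    using o assms(3) orientation_edge by fastforce
  have "orientation (X \<union> X') (D \<union> D')"
    using o assms(3) unfolding orientation_def by (rule bij_betw_combine)
  moreover have "card {a \<in> D \<union> D'. snd a = v} = card {a \<in> D \<union> D'. fst a = v}" for v
    using assms(1,2) fin disj
    by (simp only: eulerian_orientation_def balance_iff_sum finite_UnI sum.union_disjoint) simp
  ultimately show ?thesis
    by (simp add: eulerian_orientation_def)
qed

lemma balanced_orientation_triangle:
  assumes "a \<noteq> b" "a \<noteq> v" "b \<noteq> v"
  shows "balanced_orientation {{v, a}, {v, b}, {a, b}} {(v, a), (a, b), (b, v)}"
  unfolding eulerian_orientation_def
proof (intro conjI ballI)
  show "orientation {{v, a}, {v, b}, {a, b}} {(v, a), (a, b), (b, v)}"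
    using assms by (auto simp: orientation_def bij_betw_def inj_on_def doubleton_eq_iff)
  show "card {p \<in> {(v, a), (a, b), (b, v)}. snd p = x} =
      card {p \<in> {(v, a), (a, b), (b, v)}. fst p = x}" for x
    by (subst balance_iff_sum) (use assms in simp_all)
qed

text \<open>Replacing the arc from \<open>a\<close> to \<open>b\<close> by a path through
  \<open>v\<close> leaves the net flow at \<open>a\<close> and \<open>b\<close> unchanged and lets
  one arc enter and one leave \<open>v\<close>. Both edges of the path are new, so its arcs are not
  yet in \<open>D\<close>.\<close>

lemma balanced_orientation_subdivide:
  assumes "balanced_orientation (insert {a, b} X) D" "finite X" "(a, b) \<in> D"
    and "{a, b} \<notin> X" "{v, a} \<notin> X" "{v, b} \<notin> X"
    and "a \<noteq> b" "a \<noteq> v" "b \<noteq> v"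
  shows "balanced_orientation (X \<union> {{v, a}, {v, b}}) (D - {(a, b)} \<union> {(a, v), (v, b)})"
proof -
  have o: "orientation (insert {a, b} X) D"
    using assms by (simp add: eulerian_orientation_def)
  have fin: "finite D"
    using o assms(2) orientation_finite by blast
  have "bij_betw (\<lambda>(a, b). {a, b}) (D - {(a, b)}) (insert {a, b} X - {{a, b}})"
    using o assms(3) unfolding orientation_def by (intro bij_betw_DiffI bij_betw_singletonI) auto
  then have b: "bij_betw (\<lambda>(a, b). {a, b}) (D - {(a, b)}) X"
    using assms(4) by simp
  have "bij_betw (\<lambda>(a, b). {a, b}) {(a, v), (v, b)} {{v, a}, {v, b}}"
    using assms by (auto simp: bij_betw_def inj_on_def doubleton_eq_iff)
  with b have o': "orientation (X \<union> {{v, a}, {v, b}}) (D - {(a, b)} \<union> {(a, v), (v, b)})"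
    unfolding orientation_def using assms by (intro bij_betw_combine) auto
  have notin: "(a, v) \<notin> D" "(v, b) \<notin> D"
    using orientation_edge[OF o] assms by (fastforce simp: insert_commute doubleton_eq_iff)+
  have "(\<Sum>p\<in>D - {(a, b)} \<union> {(a, v), (v, b)}. of_bool (snd p = x) - of_bool (fst p = x) :: int) = 0"
    for x
  proof -
    have "(\<Sum>p\<in>D. of_bool (snd p = x) - of_bool (fst p = x) :: int) = 0"
      using assms(1) fin by (simp add: eulerian_orientation_def flip: balance_iff_sum)
    then show ?thesis
      using fin assms notin by (simp add: sum_diff1)
  qed
  then have "card {p \<in> D - {(a, b)} \<union> {(a, v), (v, b)}. snd p = x} =
      card {p \<in> D - {(a, b)} \<union> {(a, v), (v, b)}. fst p = x}" for x
    using fin by (subst balance_iff_sum) simp_all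
  then show ?thesis
    using o' unfolding eulerian_orientation_def by blast
qed

text \<open>Induction on the number of edges. A vertex \<open>v\<close> with neighbours \<open>a\<close> and \<open>b\<close> spans a triangle.
  Its symmetric difference with the edge set has fewer edges and still has even degrees, and an
  orientation of it extends by the whole triangle, or by subdividing the edge \<open>{a, b}\<close>.\<close>

lemma balanced_orientation_exists:
  assumes "finite X" "\<forall>e\<in>X. card e = 2" "even_degrees X"
  shows "\<exists>D. balanced_orientation X D"
  using assms
proof (induction "card X" arbitrary: X rule: less_induct)
  case less
  show ?case
  proof (cases "X = {}")
    case True
    then have "balanced_orientation X {}"
      by (simp add: eulerian_orientation_def orientation_def bij_betw_def)
    then show ?thesis by blast
  next
    case False
    then obtain v a where va: "{v, a} \<in> X" "v \<noteq> a"
      using less.prems(2) by (metis card_2_iff ex_in_conv)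
    \<comment> \<open>A single edge would give \<open>v\<close> odd degree, so there is a second
      neighbour \<open>b\<close>.\<close>
    have "incident_edges X v \<noteq> {{v, a}}"
      using less.prems(3) by (metis even_degrees_def is_singletonI is_singleton_altdef odd_one)
    moreover have "{v, a} \<in> incident_edges X v"
      using va by (simp add: incident_edges_def)
    ultimately obtain e where e: "e \<in> X" "v \<in> e" "e \<noteq> {v, a}"
      unfolding incident_edges_def by blast
    then obtain b where vb: "{v, b} \<in> X" "v \<noteq> b" "a \<noteq> b"
      using less.prems(2) by (metis card_2_iff doubleton_eq_iff insertE singletonD)
    define T where "T = {{v, a}, {v, b}, {a, b}}"
    define Y where "Y = X - T"
    have dist: "{v, a} \<noteq> {v, b}" "{v, a} \<noteq> {a, b}" "{v, b} \<noteq> {a, b}"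
      using va vb by (auto simp: doubleton_eq_iff)
    have "finite T" "\<forall>e\<in>T. card e = 2"
      using va vb by (auto simp: T_def)
    have even: "even_degrees (sym_diff X T)"
      using less.prems \<open>finite T\<close> even_degrees_triangle[of a b v] va vb
      by (intro even_degrees_sym_diff) (auto simp: T_def)
    have c2: "\<forall>e\<in>sym_diff X T. card e = 2"
      using less.prems \<open>\<forall>e\<in>T. card e = 2\<close> by blast
    have fY: "finite Y" using less.prems by (simp add: Y_def)
    show ?thesis
    proof (cases "{a, b} \<in> X")
      case True
      then have sd: "sym_diff X T = Y" and X: "X = Y \<union> T"
        using va vb by (auto simp: T_def Y_def)
      have "card Y < card X"
        using less.prems va by (intro psubset_card_mono) (auto simp: Y_def T_def)
      then obtain D where "balanced_orientation Y D"
        using less.hyps[of Y] even c2 fY unfolding sd by blast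
      moreover have "balanced_orientation T {(v, a), (a, b), (b, v)}"
        unfolding T_def using va(2) vb(2,3) by (intro balanced_orientation_triangle) auto
      moreover have "Y \<inter> T = {}" by (auto simp: Y_def)
      ultimately have "balanced_orientation X (D \<union> {(v, a), (a, b), (b, v)})"
        unfolding X using fY \<open>finite T\<close> by (intro balanced_orientation_Un)
      then show ?thesis by blast
    next
      case False
      then have sd: "sym_diff X T = insert {a, b} Y" and X: "X = Y \<union> {{v, a}, {v, b}}"
        using va vb by (auto simp: T_def Y_def)
      have ab: "{a, b} \<notin> Y" "{v, a} \<notin> Y" "{v, b} \<notin> Y" by (auto simp: Y_def T_def)
      \<comment> \<open>Two edges at \<open>v\<close> give way to the one edge
        \<open>{a, b}\<close>, so the induction hypothesis applies.\<close>
      have "card X = card Y + 2"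
        unfolding X using fY ab dist by (simp add: card_insert_if)
      moreover have "card (insert {a, b} Y) = card Y + 1"
        using fY ab by simp
      ultimately have "card (insert {a, b} Y) < card X" by simp
      then obtain D where D: "balanced_orientation (insert {a, b} Y) D"
        using less.hyps[of "insert {a, b} Y"] even c2 fY unfolding sd by blast
      then have "(a, b) \<in> D \<or> (b, a) \<in> D"
        by (intro orientation_cases) (auto simp: eulerian_orientation_def)
      then show ?thesis
      proof
        assume "(a, b) \<in> D"
        then have "balanced_orientation X (D - {(a, b)} \<union> {(a, v), (v, b)})"
          unfolding X using D fY ab va(2) vb(2,3) by (intro balanced_orientation_subdivide) auto
        then show ?thesis by blast
      next
        assume "(b, a) \<in> D"
        then have "balanced_orientation (Y \<union> {{v, b}, {v, a}}) (D - {(b, a)} \<union> {(b, v), (v, a)})"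
          using D fY ab va(2) vb(2,3) insert_commute[of b a "{}"]
          by (intro balanced_orientation_subdivide) auto
        moreover have "Y \<union> {{v, b}, {v, a}} = X" unfolding X by blast
        ultimately show ?thesis by (metis (no_types))
      qed
    qed
  qed
qed

text \<open>The degree is the sum of two equal numbers, the arcs entering and the arcs
  leaving.\<close>

lemma balanced_orientation_even:
  assumes "balanced_orientation X D" "finite X" "\<forall>e\<in>X. card e = 2"
  shows "even_degrees X"
  unfolding even_degrees_def
proof
  fix v
  let ?f = "\<lambda>(a, b). {a, b :: nat}"
  have o: "orientation X D"
    using assms by (simp add: eulerian_orientation_def)
  have fin: "finite D"
    using o assms orientation_finite by blast
  have inj: "inj_on ?f D" and im: "?f ` D = X"
    using o by (auto simp: orientation_def bij_betw_def)
  let ?I = "{a \<in> D. snd a = v}" and ?O = "{a \<in> D. fst a = v}"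
  have "incident_edges X v = ?f ` (?I \<union> ?O)"
    unfolding im[symmetric] incident_edges_def by auto
  then have "card (incident_edges X v) = card (?I \<union> ?O)"
    using card_image[OF inj_on_subset[OF inj], of "?I \<union> ?O"] by auto
  \<comment> \<open>Without loops no arc both enters and leaves \<open>v\<close>.\<close>
  also have "(v, v) \<notin> D"
    using orientation_edge[OF o] assms(3) by fastforce
  then have "card (?I \<union> ?O) = card ?I + card ?O"
    using fin by (intro card_Un_disjoint) (auto simp: prod_eq_iff)
  also have "card ?I = card ?O"
    using assms(1) by (simp add: eulerian_orientation_def)
  finally show "even (card (incident_edges X v))" by simp
qed


section \<open>Splitting off an oriented part\<close>

text \<open>For finite sets of two-element edges this is acyclicity, hence the later name
  \<open>forest\<close>; the form chosen avoids paths and cycles.\<close>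

definition even_free :: "nat set set \<Rightarrow> bool" where
  "even_free R \<longleftrightarrow> (\<forall>Y\<subseteq>R. even_degrees Y \<longrightarrow> Y = {})"

text \<open>The subsets of an even-free set are determined by their sets of vertices of odd degree.\<close>

lemma even_free_card_le:
  assumes "simple_graph V R" "even_free R"
  shows "card R \<le> card V"
proof -
  have fin: "finite V" "finite R"
    using assms simple_graph_finite by (auto simp: simple_graph_def)
  define odds where "odds Y = {v \<in> V. odd (card (incident_edges Y v))}" for Y
  have "inj_on odds (Pow R)"
  proof
    fix Y Z
    assume YZ: "Y \<in> Pow R" "Z \<in> Pow R" "odds Y = odds Z"
    have fYZ: "finite Y" "finite Z"
      using YZ fin finite_subset by blast+
    have "even (card (incident_edges (sym_diff Y Z) v))" for v
    proof (cases "v \<in> V")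
      case True
      then show ?thesis
        using YZ(3) unfolding even_incident_sym_diff[OF fYZ] odds_def by blast
    next
      case False
      then have "incident_edges (sym_diff Y Z) v = {}"
        using assms(1) YZ unfolding simple_graph_def incident_edges_def by blast
      then show ?thesis by simp
    qed
    then have "even_degrees (sym_diff Y Z)"
      by (simp add: even_degrees_def)
    moreover have "sym_diff Y Z \<subseteq> R" using YZ by blast
    ultimately have "sym_diff Y Z = {}"
      using assms(2) unfolding even_free_def by blast
    then show "Y = Z" by blast
  qed
  then have "card (Pow R) \<le> card (Pow V)"
    by (rule card_inj_on_le) (use fin in \<open>auto simp: odds_def\<close>)
  then show ?thesis using fin by (simp add: card_Pow)
qed

text \<open>Take \<open>R\<close> of least cardinality such that the rest of \<open>X\<close> has a
  balanced orientation. A nonempty even subset of \<open>R\<close> could be oriented by itself and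
  moved out of \<open>R\<close>, against minimality.\<close>

lemma even_free_split:
  assumes "simple_graph V X"
  shows "\<exists>R\<subseteq>X. even_free R \<and> (\<exists>D. balanced_orientation (X - R) D)"
proof -
  let ?P = "\<lambda>R. R \<subseteq> X \<and> (\<exists>D. balanced_orientation (X - R) D)"
  have "?P X"
    by (auto simp: eulerian_orientation_def orientation_def bij_betw_def)
  then obtain R where R: "?P R" and least: "\<And>S. ?P S \<Longrightarrow> card R \<le> card S"
    using ex_has_least_nat[of ?P X card] by blast
  have finX: "finite X" using assms by (rule simple_graph_finite)
  have finR: "finite R" using R finX finite_subset by blast
  have "even_free R"
    unfolding even_free_def
  proof (intro allI impI)
    fix Y
    assume Y: "Y \<subseteq> R" "even_degrees Y"
    have finY: "finite Y" using Y(1) finR finite_subset by blast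
    obtain D where D: "balanced_orientation (X - R) D" using R by blast
    have "\<forall>e\<in>Y. card e = 2"
      using Y(1) R assms unfolding simple_graph_def by blast
    with Y finY obtain D' where "balanced_orientation Y D'"
      using balanced_orientation_exists by blast
    with D have "balanced_orientation ((X - R) \<union> Y) (D \<union> D')"
      by (rule balanced_orientation_Un) (use Y finX finY in auto)
    also have "(X - R) \<union> Y = X - (R - Y)" using Y R by blast
    finally have "card R \<le> card (R - Y)"
      using R by (intro least) blast
    then have "R - Y = R"
      using finR by (intro card_seteq) auto
    then show "Y = {}" using Y(1) by blast
  qed
  with R show ?thesis by blast
qed

text \<open>The choice depends on \<open>X\<close> alone, so nodes that know the same
  \<open>X\<close> agree on it without communication. The same holds for
  \<open>split_arcs\<close>.\<close>

definition residue :: "nat set set \<Rightarrow> nat set set" where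
  "residue X = (SOME R. R \<subseteq> X \<and> even_free R \<and> (\<exists>D. balanced_orientation (X - R) D))"

definition split_arcs :: "nat set set \<Rightarrow> (nat \<times> nat) set" where
  "split_arcs X = (SOME D. balanced_orientation (X - residue X) D)"

lemma
  assumes "simple_graph V X"
  shows residue_subset: "residue X \<subseteq> X"
    and even_free_residue: "even_free (residue X)"
    and balanced_orientation_split_arcs: "balanced_orientation (X - residue X) (split_arcs X)"
proof -
  have "residue X \<subseteq> X \<and> even_free (residue X) \<and> (\<exists>D. balanced_orientation (X - residue X) D)"
    unfolding residue_def by (rule someI_ex) (use even_free_split[OF assms] in blast)
  then show "residue X \<subseteq> X" "even_free (residue X)"
    "balanced_orientation (X - residue X) (split_arcs X)"
    unfolding split_arcs_def by (auto intro: someI_ex)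
qed


section \<open>Merging the edges along a binary tree of groups\<close>

text \<open>The group \<open>g\<close> of level \<open>k\<close> consists of the nodes \<open>v\<close> with \<open>v div 2 ^ k = g\<close>, and an edge belongs
  to its smaller endpoint.\<close>

definition group_edges :: "nat set set \<Rightarrow> nat \<Rightarrow> nat \<Rightarrow> nat set set" where
  "group_edges E k g = {e \<in> E. Min e div 2 ^ k = g}"

text \<open>The edges still unoriented when the two halves of a group unite. A group index is an
  identifier without its last \<open>k\<close> bits, so the halves of \<open>g\<close> are
  \<open>2 * g\<close> and \<open>2 * g + 1\<close>.\<close>

primrec pool :: "nat set set \<Rightarrow> nat \<Rightarrow> nat \<Rightarrow> nat set set" where
  "pool E 0 g = group_edges E 0 g"
| "pool E (Suc k) g = residue (pool E k (2 * g)) \<union> residue (pool E k (2 * g + 1))"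

abbreviation forest :: "nat set set \<Rightarrow> nat \<Rightarrow> nat \<Rightarrow> nat set set" where
  "forest E k g \<equiv> residue (pool E k g)"

primrec arcs :: "nat set set \<Rightarrow> nat \<Rightarrow> nat \<Rightarrow> (nat \<times> nat) set" where
  "arcs E 0 g = split_arcs (pool E 0 g)"
| "arcs E (Suc k) g = arcs E k (2 * g) \<union> arcs E k (2 * g + 1) \<union> split_arcs (pool E (Suc k) g)"

lemma group_edges_Suc:
  "group_edges E (Suc k) g = group_edges E k (2 * g) \<union> group_edges E k (2 * g + 1)"
proof -
  have "m div (2 * 2 ^ k) = g \<longleftrightarrow> m div 2 ^ k = 2 * g \<or> m div 2 ^ k = 2 * g + 1" for m :: nat
    by (simp add: div_mult2_eq mult.commute[of 2]) linarith
  then show ?thesis by (auto simp: group_edges_def)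
qed

lemma group_edges_disjoint: "g \<noteq> h \<Longrightarrow> group_edges E k g \<inter> group_edges E k h = {}"
  by (auto simp: group_edges_def)

lemma simple_graph_group_edges: "simple_graph V E \<Longrightarrow> simple_graph V (group_edges E k g)"
  by (erule simple_graph_subset) (auto simp: group_edges_def)

lemma pool_subset: "simple_graph V E \<Longrightarrow> pool E k g \<subseteq> group_edges E k g"
proof (induction k arbitrary: g)
  case (Suc k)
  have "forest E k h \<subseteq> group_edges E k h" for h
    using residue_subset[OF simple_graph_subset, OF simple_graph_group_edges[OF Suc.prems] Suc.IH]
      Suc by blast
  then show ?case unfolding group_edges_Suc by fastforce
qed simp

lemma simple_graph_pool: "simple_graph V E \<Longrightarrow> simple_graph V (pool E k g)"
  using simple_graph_subset[OF simple_graph_group_edges pool_subset] .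

lemma forest_subset: "simple_graph V E \<Longrightarrow> forest E k g \<subseteq> group_edges E k g"
  using residue_subset[OF simple_graph_pool] pool_subset by blast

text \<open>This bound lets a forest be spread over the nodes, one edge each.\<close>

lemma forest_card_le:
  assumes "simple_graph V E"
  shows "card (forest E k g) \<le> card V"
  using even_free_card_le[OF simple_graph_subset[OF simple_graph_pool residue_subset]]
    even_free_residue simple_graph_pool assms by blast

text \<open>The smaller endpoint of an edge is a node, so a group without members owns no edge. Such
  groups occur because identifiers may have gaps, and nobody announces their forests.\<close>

lemma forest_empty:
  assumes "simple_graph V E" "\<forall>v\<in>V. v div 2 ^ k \<noteq> g"
  shows "forest E k g = {}"
proof -
  have "Min e \<in> V" if "e \<in> E" for e
    using assms(1) that Min_in[of e] unfolding simple_graph_def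
    by (metis card.empty card.infinite subset_eq zero_neq_numeral)
  then have "group_edges E k g = {}"
    using assms(2) by (auto simp: group_edges_def)
  then show ?thesis
    using forest_subset[OF assms(1)] by blast
qed

text \<open>The invariant of the merging: the arcs of both halves and those split off the pool
  orient three disjoint edge sets.\<close>

lemma balanced_orientation_arcs:
  assumes "simple_graph V E"
  shows "balanced_orientation (group_edges E k g - forest E k g) (arcs E k g)"
proof (induction k arbitrary: g)
  case 0
  then show ?case
    using balanced_orientation_split_arcs[OF simple_graph_pool[OF assms], of 0 g] by simp
next
  case (Suc k)
  let ?L = "\<lambda>h. group_edges E k h" and ?F = "\<lambda>h. forest E k h"
  have fin: "finite (group_edges E j h)" for j h
    using simple_graph_group_edges[OF assms] by (rule simple_graph_finite)
  have F: "?F h \<subseteq> ?L h" for h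
    by (rule forest_subset[OF assms])
  have disj: "?L (2 * g) \<inter> ?L (2 * g + 1) = {}"
    by (rule group_edges_disjoint) simp
  have R: "forest E (Suc k) g \<subseteq> pool E (Suc k) g"
    using residue_subset[OF simple_graph_pool[OF assms]] .
  have P: "pool E (Suc k) g \<subseteq> group_edges E (Suc k) g"
    by (rule pool_subset[OF assms])
  have 1: "balanced_orientation ((?L (2 * g) - ?F (2 * g)) \<union> (?L (2 * g + 1) - ?F (2 * g + 1)))
      (arcs E k (2 * g) \<union> arcs E k (2 * g + 1))"
    using disj fin by (intro balanced_orientation_Un Suc) auto
  \<comment> \<open>What the halves leave unoriented is exactly the pool of the united
    group.\<close>
  have 2: "(?L (2 * g) - ?F (2 * g)) \<union> (?L (2 * g + 1) - ?F (2 * g + 1)) =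
      group_edges E (Suc k) g - pool E (Suc k) g"
    using F[of "2 * g"] F[of "2 * g + 1"] disj unfolding group_edges_Suc pool.simps by blast
  have 3: "balanced_orientation
      ((group_edges E (Suc k) g - pool E (Suc k) g) \<union> (pool E (Suc k) g - forest E (Suc k) g))
      (arcs E (Suc k) g)"
    unfolding arcs.simps(2) using 1[unfolded 2] finite_subset[OF P fin] fin
    by (intro balanced_orientation_Un balanced_orientation_split_arcs[OF simple_graph_pool[OF assms]])
      auto
  have 4: "(group_edges E (Suc k) g - pool E (Suc k) g) \<union> (pool E (Suc k) g - forest E (Suc k) g) =
      group_edges E (Suc k) g - forest E (Suc k) g"
    using R P by blast
  show ?case using 3[unfolded 4] .
qed

lemma arcs_edge:
  assumes "simple_graph V E" "(a, b) \<in> arcs E k g"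
  shows "{a, b} \<in> E" "min a b div 2 ^ k = g"
proof -
  have "{a, b} \<in> group_edges E k g"
    using balanced_orientation_arcs[OF assms(1), of k g] assms(2) orientation_edge
    unfolding eulerian_orientation_def by blast
  then show "{a, b} \<in> E" "min a b div 2 ^ k = g" by (auto simp: group_edges_def)
qed

text \<open>The forest of the whole graph has even degrees, being the difference of the graph and an
  oriented set.\<close>

lemma eulerian_orientation_arcs:
  assumes "eulerian_graph V E" "\<forall>v\<in>V. v < 2 ^ k"
  shows "eulerian_orientation UNIV E (arcs E k 0)"
proof -
  have sg: "simple_graph V E" using assms(1) by (simp add: eulerian_graph_def)
  have fin: "finite E" using simple_graph_finite[OF sg] .
  have "Min e < 2 ^ k" if "e \<in> E" for e
    using sg that assms(2) Min_in[of e] unfolding simple_graph_def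
    by (metis card.empty card.infinite subset_eq zero_neq_numeral)
  then have L: "group_edges E k 0 = E" by (auto simp: group_edges_def)
  have b: "balanced_orientation (E - forest E k 0) (arcs E k 0)"
    using balanced_orientation_arcs[OF sg, of k 0] by (simp add: L)
  have sub: "forest E k 0 \<subseteq> E" using forest_subset[OF sg, of k 0] L by simp
  have "even_degrees (E - forest E k 0)"
    using b fin sg by (intro balanced_orientation_even) (auto simp: simple_graph_def)
  moreover have "even (card (incident_edges E v))" for v
  proof (cases "v \<in> V")
    case False
    then have "incident_edges E v = {}"
      using sg unfolding simple_graph_def incident_edges_def by blast
    then show ?thesis by simp
  qed (use assms(1) in \<open>simp add: eulerian_graph_def\<close>)
  then have "even_degrees E" by (simp add: even_degrees_def)
  ultimately have "even_degrees (sym_diff E (E - forest E k 0))"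
    using fin by (intro even_degrees_sym_diff) auto
  moreover have "sym_diff E (E - forest E k 0) = forest E k 0" using sub by blast
  ultimately have "forest E k 0 = {}"
    using even_free_residue[OF simple_graph_pool[OF sg], of k 0] by (auto simp: even_free_def)
  then show ?thesis using b by simp
qed

section \<open>The recursion seen from one group and from one node\<close>

definition sibling :: "nat \<Rightarrow> nat" where
  "sibling h = (if even h then h + 1 else h - 1)"

lemma siblings: "{2 * (h div 2), 2 * (h div 2) + 1} = {h, sibling h}"
  by (auto simp: sibling_def elim!: evenE oddE)

text \<open>The recursion from the viewpoint of a child, whichever of the two halves it is.\<close>

lemma pool_Suc_sibling: "pool E (Suc k) (h div 2) = forest E k h \<union> forest E k (sibling h)"
proof -
  have "pool E (Suc k) (h div 2) = (\<Union>j\<in>{2 * (h div 2), 2 * (h div 2) + 1}. forest E k j)"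
    by simp
  then show ?thesis unfolding siblings by simp
qed

lemma arcs_Suc_sibling:
  "arcs E (Suc k) (h div 2) =
     arcs E k h \<union> arcs E k (sibling h) \<union> split_arcs (pool E (Suc k) (h div 2))"
proof -
  have "arcs E (Suc k) (h div 2) =
      (\<Union>j\<in>{2 * (h div 2), 2 * (h div 2) + 1}. arcs E k j) \<union> split_arcs (pool E (Suc k) (h div 2))"
    by auto
  then show ?thesis unfolding siblings by simp
qed

text \<open>A member learns the forest of the sibling group but not the arcs oriented there, so it
  only tracks the arcs on edges whose smaller endpoint it is.\<close>

definition own_arcs :: "nat set set \<Rightarrow> nat \<Rightarrow> nat \<Rightarrow> (nat \<times> nat) set" where
  "own_arcs E k v = {(a, b) \<in> arcs E k (v div 2 ^ k). min a b = v}"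

lemma own_arcs_0: "own_arcs E 0 v = {(a, b) \<in> split_arcs (pool E 0 v). min a b = v}"
  by (simp add: own_arcs_def)

text \<open>Arcs of the sibling group lie on edges owned there, so none of them concerns
  \<open>v\<close>; the pool is all that is needed of the sibling.\<close>

lemma own_arcs_Suc:
  assumes "simple_graph V E"
  shows "own_arcs E (Suc k) v =
    own_arcs E k v \<union> {(a, b) \<in> split_arcs (pool E (Suc k) (v div 2 ^ k div 2)). min a b = v}"
proof -
  have "sibling h \<noteq> h" for h by (cases h) (auto simp: sibling_def)
  then have "min a b \<noteq> v" if "(a, b) \<in> arcs E k (sibling (v div 2 ^ k))" for a b
    using arcs_edge(2)[OF assms that] by metis
  moreover have "v div 2 ^ Suc k = v div 2 ^ k div 2"
    unfolding power_Suc2 by (rule div_mult2_eq)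
  ultimately show ?thesis
    unfolding own_arcs_def by (auto simp: arcs_Suc_sibling simp del: arcs.simps)
qed


section \<open>Realizing a message schedule by an algorithm\<close>

text \<open>Messages are prescribed from the whole instance; that nodes can compute them is a
  separate claim about \<open>view\<close>.\<close>

type_synonym schedule = "nat set \<Rightarrow> nat set set \<Rightarrow> nat \<Rightarrow> nat \<Rightarrow> nat \<Rightarrow> message option"

definition received :: "schedule \<Rightarrow> nat set \<Rightarrow> nat set set \<Rightarrow> nat \<Rightarrow> nat \<Rightarrow> nat \<Rightarrow> message option" where
  "received M V E t v u = (if u \<in> V \<and> u \<noteq> v then M V E t u v else None)"

text \<open>The knowledge of a node if everybody follows the schedule.\<close>

definition view :: "schedule \<Rightarrow> nat set \<Rightarrow> nat set set \<Rightarrow> nat \<Rightarrow> nat \<Rightarrow> knowledge" where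
  "view M V E t v = \<lparr>num_nodes = card V, own_id = v, own_edges = incident_edges E v,
     inboxes = map (\<lambda>s. received M V E s v) [0..<t]\<rparr>"

lemma view_eq_iff:
  "view M V E t v = view M V' E' t v \<longleftrightarrow> card V = card V' \<and>
     incident_edges E v = incident_edges E' v \<and>
     (\<forall>s<t. \<forall>u. received M V E s v u = received M V' E' s v u)"
  by (auto simp: view_def fun_eq_iff)

lemma view_eq_mono: "view M V E t v = view M V' E' t v \<Longrightarrow> s \<le> t \<Longrightarrow> view M V E s v = view M V' E' s v"
  by (auto simp: view_eq_iff)

text \<open>A node can follow a schedule without decoding its inboxes: it guesses any instance that agrees
  with its view. Hence it suffices that equal views prescribe equal messages and outputs.\<close>

lemma schedule_realizable:
  fixes M :: schedule and out :: "nat set \<Rightarrow> nat set set \<Rightarrow> nat \<Rightarrow> 'o"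
  assumes M: "\<And>V E V' E' t v. P V E \<Longrightarrow> P V' E' \<Longrightarrow> v \<in> V \<Longrightarrow> v \<in> V' \<Longrightarrow>
      view M V E t v = view M V' E' t v \<Longrightarrow> M V E t v = M V' E' t v"
    and out: "\<And>V E V' E' v. P V E \<Longrightarrow> P V' E' \<Longrightarrow> v \<in> V \<Longrightarrow> v \<in> V' \<Longrightarrow> card V = card V' \<Longrightarrow>
      view M V E (T (card V)) v = view M V' E' (T (card V)) v \<Longrightarrow> out V E v = out V' E' v"
  shows "\<exists>A :: 'o cc_algorithm. \<forall>V E. P V E \<longrightarrow>
    (\<forall>t. \<forall>v\<in>V. send A (cc_run A V E t v) = M V E t v) \<and>
    (\<forall>v\<in>V. result A (cc_run A V E (T (card V)) v) = out V E v)"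
proof -
  define fits where "fits K = (\<lambda>(V, E). P V E \<and> own_id K \<in> V \<and>
    view M V E (length (inboxes K)) (own_id K) = K)" for K
  define guess where "guess K = (SOME I. fits K I)" for K
  define A where "A = \<lparr>send = (\<lambda>K. M (fst (guess K)) (snd (guess K)) (length (inboxes K)) (own_id K)),
    result = (\<lambda>K. out (fst (guess K)) (snd (guess K)) (own_id K))\<rparr>"
  have view_simps: "length (inboxes (view M V E t v)) = t" "own_id (view M V E t v) = v" for V E t v
    by (auto simp: view_def)
  have guess: "P V' E' \<and> v \<in> V' \<and> view M V' E' t v = view M V E t v"
    if "P V E" "v \<in> V" "guess (view M V E t v) = (V', E')" for V E t v V' E'
  proof -
    have "fits (view M V E t v) (V, E)"
      using that by (simp add: fits_def view_simps)
    then have "fits (view M V E t v) (guess (view M V E t v))"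
      unfolding guess_def by (rule someI)
    then show ?thesis by (simp add: that(3) fits_def view_simps)
  qed
  have send: "send A (view M V E t v) = M V E t v" if "P V E" "v \<in> V" for V E t v
  proof -
    obtain V' E' where g: "guess (view M V E t v) = (V', E')" by fastforce
    with guess[OF that g] that show ?thesis
      by (auto simp: A_def view_simps intro: M)
  qed
  have result: "result A (view M V E (T (card V)) v) = out V E v" if "P V E" "v \<in> V" for V E v
  proof -
    obtain V' E' where g: "guess (view M V E (T (card V)) v) = (V', E')" by fastforce
    note guess[OF that g]
    \<comment> \<open>The number of nodes is part of the view, so the guessed instance has the same
      number of rounds.\<close>
    moreover from this have "card V' = card V" by (simp add: view_eq_iff)
    ultimately show ?thesis
      using that by (auto simp: A_def view_simps g intro: out)
  qed
  \<comment> \<open>Sending depends on the view only, so induction over the rounds, for all nodes at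
    once, identifies actual and prescribed knowledge.\<close>
  have run: "cc_run A V E t v = view M V E t v" if "P V E" "v \<in> V" for V E t v
    using that(2)
  proof (induction t arbitrary: v)
    case (Suc t)
    have "(if u \<in> V \<and> u \<noteq> v then send A (cc_run A V E t u) v else None) = received M V E t v u" for u
      using Suc.IH[of u] send[OF that(1), of u] by (simp add: received_def)
    then show ?case using Suc by (simp add: view_def)
  qed (simp add: view_def)
  show ?thesis
    using run send result by (intro exI[of _ A]) simp
qed


section \<open>The protocol\<close>

text \<open>Distributes a set of at most \<open>card V\<close> edges over the nodes, at most one edge each.\<close>

definition slot :: "nat set \<Rightarrow> nat set set \<Rightarrow> nat \<Rightarrow> nat set option" where
  "slot V X = (SOME s. {e. \<exists>w\<in>V. s w = Some e} = X)"

text \<open>Any injection of \<open>X\<close> into \<open>V\<close> yields a placement. As it is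
  chosen from \<open>V\<close> and \<open>X\<close> alone, all nodes knowing both use the same
  one.\<close>

lemma slot:
  assumes "finite V" "finite X" "card X \<le> card V"
  shows "{e. \<exists>w\<in>V. slot V X w = Some e} = X"
proof -
  obtain h where h: "h ` X \<subseteq> V" "inj_on h X"
    using card_le_inj[OF assms(2,1,3)] by blast
  have "{e. \<exists>w\<in>V. (if w \<in> h ` X then Some (inv_into X h w) else None) = Some e} = X"
    using h by (auto split: if_splits) (metis image_eqI image_subset_iff inv_into_f_f)
  then show ?thesis
    unfolding slot_def by (rule someI[of "\<lambda>s. {e. \<exists>w\<in>V. s w = Some e} = X"])
qed

text \<open>At level \<open>levels n\<close> all identifiers below \<open>n ^ c\<close> fall into
  group 0, so the merging ends there. Injectivity of \<open>code\<close> serves correctness; its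
  length enters only with the bandwidth.\<close>

locale protocol =
  fixes c :: nat and levels :: "nat \<Rightarrow> nat" and code :: "nat \<Rightarrow> nat set \<Rightarrow> message"
  assumes levels: "n ^ c \<le> 2 ^ levels n"
    and code: "inj_on (code n) {e. e \<subseteq> {..<n ^ c} \<and> card e = 2}"
begin

text \<open>Round \<open>0\<close> makes the identifiers known. In round \<open>2 * k + 1\<close> each member of a group of level \<open>k\<close>
  distributes the forest of the group over all nodes, and in round \<open>2 * k + 2\<close> these pass it on to the
  sibling group. In the last round each edge is reported to its larger endpoint.\<close>

definition messages :: schedule where
  "messages V E t u w =
     (if t = 0 then Some []
      else if t \<le> 2 * levels (card V) then
        let k = (t - 1) div 2 in
        map_option (code (card V))
          (if odd t then slot V (forest E k (u div 2 ^ k)) w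
           else slot V (forest E k (sibling (w div 2 ^ k))) u)
      else if t = 2 * levels (card V) + 1 \<and> u < w \<and> (u, w) \<in> own_arcs E (levels (card V)) u then Some []
      else None)"

lemma messages_0: "messages V E 0 u w = Some []"
  by (simp add: messages_def)

lemma messages_odd:
  "k < levels (card V) \<Longrightarrow> messages V E (2 * k + 1) u w =
     map_option (code (card V)) (slot V (forest E k (u div 2 ^ k)) w)"
  by (simp add: messages_def)

text \<open>A relay \<open>u\<close> holds one slot of the forest of every group and selects by
  recipient.\<close>

lemma messages_even:
  "k < levels (card V) \<Longrightarrow> messages V E (2 * k + 2) u w =
     map_option (code (card V)) (slot V (forest E k (sibling (w div 2 ^ k))) u)"
  by (simp add: messages_def)

text \<open>The presence of the empty message is the information: it announces an arc from the
  smaller to the larger endpoint.\<close>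

lemma messages_last:
  "messages V E (2 * levels (card V) + 1) u w =
     (if u < w \<and> (u, w) \<in> own_arcs E (levels (card V)) u then Some [] else None)"
  by (simp add: messages_def)

lemma messages_after: "t > 2 * levels (card V) + 1 \<Longrightarrow> messages V E t u w = None"
  by (simp add: messages_def)

definition valid :: "nat set \<Rightarrow> nat set set \<Rightarrow> bool" where
  "valid V E \<longleftrightarrow> simple_graph V E \<and> short_ids c V"

abbreviation indist :: "nat set \<Rightarrow> nat set set \<Rightarrow> nat set \<Rightarrow> nat set set \<Rightarrow> nat \<Rightarrow> nat \<Rightarrow> bool" where
  "indist V E V' E' t v \<equiv> view messages V E t v = view messages V' E' t v"

lemma slot_forest:
  assumes "valid V E"
  shows "{e. \<exists>w\<in>V. slot V (forest E k g) w = Some e} = forest E k g"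
proof (rule slot)
  have sg: "simple_graph V E" using assms by (simp add: valid_def)
  show "finite V" using sg by (simp add: simple_graph_def)
  show "finite (forest E k g)"
    using forest_subset[OF sg] simple_graph_group_edges[OF sg] simple_graph_finite finite_subset by blast
  show "card (forest E k g) \<le> card V" using sg by (rule forest_card_le)
qed

lemma slot_forest_edge:
  assumes "valid V E" "w \<in> V" "slot V (forest E k g) w = Some e"
  shows "e \<in> {e. e \<subseteq> {..<card V ^ c} \<and> card e = 2}"
proof -
  have "e \<in> forest E k g"
    using slot_forest[OF assms(1)] assms(2,3) by blast
  then have "e \<in> E"
    using forest_subset assms(1) unfolding valid_def group_edges_def by blast
  then show ?thesis
    using assms(1) unfolding valid_def simple_graph_def short_ids_def by blast
qed

lemma code_slot_eq:
  assumes "valid V E" "valid V E'" "w \<in> V"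
    and "map_option (code (card V)) (slot V (forest E k g) w) =
      map_option (code (card V)) (slot V (forest E' k g) w)"
  shows "slot V (forest E k g) w = slot V (forest E' k g) w"
  using assms(4) slot_forest_edge[OF assms(1,3)] slot_forest_edge[OF assms(2,3)]
    inj_onD[OF code[of "card V"]]
  by (cases "slot V (forest E k g) w"; cases "slot V (forest E' k g) w") auto

section \<open>What a node can infer: agreement of two instances it cannot tell apart\<close>

context
  fixes V V' :: "nat set" and E E' :: "nat set set"
  assumes valid: "valid V E" "valid V' E'"
begin

lemma simple: "simple_graph V E" "simple_graph V' E'"
  using valid by (auto simp: valid_def)

text \<open>The empty messages of round 0 reveal their senders.\<close>

lemma indist_nodes:
  assumes "v \<in> V" "v \<in> V'" "indist V E V' E' t v" "t > 0"
  shows "V' = V"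
proof -
  have "received messages V E 0 v u = received messages V' E' 0 v u" for u
    using assms by (simp add: view_eq_iff)
  then have "u \<in> V \<longleftrightarrow> u \<in> V'" if "u \<noteq> v" for u
    using that by (metis messages_0 option.distinct(1) received_def)
  then show ?thesis using assms(1,2) by (metis subset_antisym subsetI)
qed

lemma indist_message:
  assumes "v \<in> V" "v \<in> V'" "indist V E V' E' t v" "s < t" "u \<in> V" "u \<noteq> v"
  shows "messages V E s u v = messages V E' s u v"
proof -
  have "V' = V" using assms by (intro indist_nodes) auto
  then show ?thesis
    using assms unfolding view_eq_iff received_def by metis
qed

text \<open>A node outside a group hears of its forest from any member; a group without members has no
  edges.\<close>

lemma indist_slot:
  assumes v: "v \<in> V" "v \<in> V'" and ind: "indist V E V' E' (2 * k + 2) v" and k: "k < levels (card V)"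
    and own: "forest E k (v div 2 ^ k) = forest E' k (v div 2 ^ k)"
  shows "slot V (forest E k g) v = slot V (forest E' k g) v"
proof -
  have V: "V' = V" using v ind by (intro indist_nodes) auto
  consider "v div 2 ^ k = g" | u where "u \<in> V" "u \<noteq> v" "u div 2 ^ k = g" | "\<forall>u\<in>V. u div 2 ^ k \<noteq> g"
    by blast
  then show ?thesis
  proof cases
    case 1
    then show ?thesis using own by simp
  next
    case 2
    then have "messages V E (2 * k + 1) u v = messages V E' (2 * k + 1) u v"
      using v ind by (intro indist_message[where t = "2 * k + 2"]) auto
    then have "map_option (code (card V)) (slot V (forest E k g) v) =
        map_option (code (card V)) (slot V (forest E' k g) v)"
      using 2 k by (simp only: messages_odd)
    then show ?thesis
      using valid v V by (intro code_slot_eq) auto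
  next
    case 3
    then have "forest E k g = {}" "forest E' k g = {}"
      using forest_empty[OF simple(1)] forest_empty[OF simple(2)] V by auto
    then show ?thesis by simp
  qed
qed

text \<open>The slots of all nodes together make up the forest. The relays deliver theirs in round
  \<open>2 * k + 2\<close>; the slot of \<open>v\<close> itself is known from the round
  before.\<close>

lemma indist_forest_sibling:
  assumes v: "v \<in> V" "v \<in> V'" and ind: "indist V E V' E' (2 * k + 3) v" and k: "k < levels (card V)"
    and own: "forest E k (v div 2 ^ k) = forest E' k (v div 2 ^ k)"
  shows "forest E k (sibling (v div 2 ^ k)) = forest E' k (sibling (v div 2 ^ k))"
proof -
  let ?g = "sibling (v div 2 ^ k)"
  have V: "V' = V" using v ind by (intro indist_nodes) auto
  have "slot V (forest E k ?g) w = slot V (forest E' k ?g) w" if "w \<in> V" for w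
  proof (cases "w = v")
    case True
    have "indist V E V' E' (2 * k + 2) v"
      by (rule view_eq_mono[OF ind]) simp
    from indist_slot[OF v this k own] show ?thesis
      unfolding True .
  next
    case False
    then have "messages V E (2 * k + 2) w v = messages V E' (2 * k + 2) w v"
      using v ind that by (intro indist_message[where t = "2 * k + 3"]) auto
    then have "map_option (code (card V)) (slot V (forest E k ?g) w) =
        map_option (code (card V)) (slot V (forest E' k ?g) w)"
      using k by (simp only: messages_even)
    then show ?thesis
      using valid that V by (intro code_slot_eq) auto
  qed
  then have "{e. \<exists>w\<in>V. slot V (forest E k ?g) w = Some e} = {e. \<exists>w\<in>V. slot V (forest E' k ?g) w = Some e}"
    by (intro Collect_cong bex_cong) simp_all
  then show ?thesis
    unfolding slot_forest[OF valid(1)] slot_forest[OF valid(2), unfolded V] .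
qed

text \<open>Edges with smaller endpoint \<open>v\<close> are incident to \<open>v\<close>, hence
  known initially.\<close>

lemma indist_pool_0:
  assumes "indist V E V' E' t v"
  shows "pool E 0 v = pool E' 0 v"
proof -
  have "pool X 0 v = {e \<in> incident_edges X v. Min e = v}" if "simple_graph U X" for U X
  proof -
    have "Min e \<in> e" if "e \<in> X" for e
      using \<open>simple_graph U X\<close> that Min_in[of e] unfolding simple_graph_def
      by (metis card.empty card.infinite zero_neq_numeral)
    then show ?thesis by (auto simp: group_edges_def incident_edges_def)
  qed
  then show ?thesis
    using simple assms view_eq_iff by metis
qed

text \<open>The locality invariant after rounds 0 to \<open>2 * k\<close>. In the step, the
  sibling's forest completes the pool, which determines the new residue and arcs.\<close>

lemma indist_group:
  assumes "v \<in> V" "v \<in> V'" "indist V E V' E' (2 * k + 1) v" "k \<le> levels (card V)"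
  shows "forest E k (v div 2 ^ k) = forest E' k (v div 2 ^ k) \<and> own_arcs E k v = own_arcs E' k v"
  using assms(3,4)
proof (induction k)
  case 0
  then show ?case
    using indist_pool_0 by (simp add: own_arcs_0 del: pool.simps)
next
  case (Suc k)
  have ind: "indist V E V' E' (2 * k + 3) v"
    using Suc.prems by (simp add: numeral_eq_Suc)
  have k: "k < levels (card V)" using Suc.prems by simp
  have IH: "forest E k (v div 2 ^ k) = forest E' k (v div 2 ^ k)" "own_arcs E k v = own_arcs E' k v"
    using Suc.IH[OF view_eq_mono[OF ind]] k by auto
  have pool: "pool E (Suc k) (v div 2 ^ k div 2) = pool E' (Suc k) (v div 2 ^ k div 2)"
    unfolding pool_Suc_sibling
    using IH(1) indist_forest_sibling[OF assms(1,2) ind k IH(1)] by simp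
  have "v div 2 ^ Suc k = v div 2 ^ k div 2"
    unfolding power_Suc2 by (rule div_mult2_eq)
  then show ?case
    using pool IH(2) own_arcs_Suc[OF simple(1)] own_arcs_Suc[OF simple(2)] by presburger
qed

lemma indist_messages:
  assumes v: "v \<in> V" "v \<in> V'" and ind: "indist V E V' E' t v"
  shows "messages V E t v = messages V' E' t v"
proof (cases "t = 0")
  case True
  then show ?thesis by (simp add: messages_0 fun_eq_iff)
next
  case False
  then have V: "V' = V" using v ind by (intro indist_nodes) auto
  define k where "k = (t - 1) div 2"
  have k: "t = 2 * k + 1 \<or> t = 2 * k + 2"
    using False unfolding k_def by presburger
  then have "k < levels (card V) \<or> t = 2 * levels (card V) + 1 \<or> t > 2 * levels (card V) + 1"
    by arith
  with k consider "t = 2 * k + 1" "k < levels (card V)" | "t = 2 * k + 2" "k < levels (card V)"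
    | "t = 2 * levels (card V) + 1" | "t > 2 * levels (card V) + 1"
    by blast
  then show ?thesis
  proof cases
    case 1
    then show ?thesis
      using indist_group[OF v, of k] ind by (simp only: V messages_odd fun_eq_iff) simp
  next
    case 2
    have "indist V E V' E' (2 * k + 1) v"
      by (rule view_eq_mono[OF ind]) (simp add: 2)
    then have "forest E k (v div 2 ^ k) = forest E' k (v div 2 ^ k)"
      using indist_group[OF v, of k] 2 by simp
    then show ?thesis
      using indist_slot[OF v, of k] ind 2 by (simp only: V messages_even fun_eq_iff) simp
  next
    case 3
    then show ?thesis
      using indist_group[OF v, of "levels (card V)"] ind by (simp only: V messages_last fun_eq_iff) simp
  next
    case 4
    then show ?thesis by (simp add: V messages_after fun_eq_iff)
  qed
qed

end

section \<open>The output of the protocol\<close>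

definition solution :: "nat set \<Rightarrow> nat set set \<Rightarrow> (nat \<times> nat) set" where
  "solution V E = arcs E (levels (card V)) 0"

lemma ids_below:
  assumes "valid V E" "v \<in> V"
  shows "v < 2 ^ levels (card V)"
  using assms levels[of "card V"] unfolding valid_def short_ids_def by (meson less_le_trans)

lemma own_arcs_solution:
  assumes "valid V E" "v \<in> V"
  shows "own_arcs E (levels (card V)) v = {(a, b) \<in> solution V E. min a b = v}"
  using ids_below[OF assms] by (simp add: own_arcs_def solution_def)

lemma eulerian_orientation_solution:
  assumes "valid V E" "eulerian_graph V E"
  shows "balanced_orientation E (solution V E)"
  unfolding solution_def using assms ids_below by (intro eulerian_orientation_arcs) auto

text \<open>Describes the output of \<open>v\<close> by data in its view. Edges on which
  \<open>v\<close> is the smaller endpoint are in \<open>own_arcs\<close>; on the others a message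
  in the last round means an arc into \<open>v\<close>, and silence an arc out of
  \<open>v\<close>.\<close>

lemma mem_incident_solution:
  assumes "valid V E" "eulerian_graph V E" "v \<in> V"
  shows "(a, b) \<in> incident_arcs (solution V E) v \<longleftrightarrow>
    (a, b) \<in> own_arcs E (levels (card V)) v \<or>
    b = v \<and> a < v \<and> received messages V E (2 * levels (card V) + 1) v a = Some [] \<or>
    a = v \<and> b < v \<and> {a, b} \<in> incident_edges E v \<and>
      received messages V E (2 * levels (card V) + 1) v b \<noteq> Some []"
proof -
  have o: "orientation E (solution V E)"
    using eulerian_orientation_solution[OF assms(1,2)] by (simp add: eulerian_orientation_def)
  have E: "{x, y} \<in> E \<and> x \<in> V \<and> y \<in> V \<and> x \<noteq> y" if "(x, y) \<in> solution V E" for x y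
  proof -
    have "{x, y} \<in> E" using orientation_edge[OF o that] .
    moreover from this have "{x, y} \<subseteq> V" "card {x, y} = 2"
      using assms(1) by (auto simp: valid_def simple_graph_def)
    ultimately show ?thesis by (auto simp: card_insert_if split: if_splits)
  qed
  have r: "received messages V E (2 * levels (card V) + 1) v x = Some [] \<longleftrightarrow> (x, v) \<in> solution V E"
    if "x < v" for x
    unfolding received_def messages_last
    using own_arcs_solution[OF assms(1), of x] that E[of x v] by auto
  have s: "(v, x) \<in> solution V E \<longleftrightarrow> {v, x} \<in> incident_edges E v \<and> (x, v) \<notin> solution V E"
    if "x < v" for x
    using E[of v x] orientation_cases[OF o, of v x] orientation_asym[OF o, of v x]
    by (auto simp: incident_edges_def)
  have "(a, b) \<in> incident_arcs (solution V E) v \<longleftrightarrow>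
      (a, b) \<in> solution V E \<and> (min a b = v \<or> b = v \<and> a < v \<or> a = v \<and> b < v)"
    using E[of a b] by (auto simp: incident_arcs_def min_def)
  also have "\<dots> \<longleftrightarrow> (a, b) \<in> own_arcs E (levels (card V)) v \<or>
      b = v \<and> a < v \<and> (a, v) \<in> solution V E \<or> a = v \<and> b < v \<and> (v, b) \<in> solution V E"
    unfolding own_arcs_solution[OF assms(1,3)] by auto
  finally show ?thesis
    using r[of a] r[of b] s[of b] by blast
qed

lemma indist_solution:
  assumes valid: "valid V E" "valid V' E'" and eul: "eulerian_graph V E" "eulerian_graph V' E'"
    and v: "v \<in> V" "v \<in> V'" and ind: "view messages V E (2 * levels (card V) + 2) v =
      view messages V' E' (2 * levels (card V) + 2) v"
  shows "incident_arcs (solution V E) v = incident_arcs (solution V' E') v"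
proof -
  have card: "card V' = card V" and inc: "incident_edges E v = incident_edges E' v"
    and rec: "received messages V E (2 * levels (card V) + 1) v =
      received messages V' E' (2 * levels (card V) + 1) v"
    using ind by (auto simp: view_eq_iff fun_eq_iff)
  have own: "own_arcs E (levels (card V)) v = own_arcs E' (levels (card V)) v"
    using indist_group[OF valid v view_eq_mono[OF ind]] by simp
  have "p \<in> incident_arcs (solution V E) v \<longleftrightarrow> p \<in> incident_arcs (solution V' E') v" for p
    by (cases p) (simp only: mem_incident_solution[OF valid(1) eul(1) v(1)]
        mem_incident_solution[OF valid(2) eul(2) v(2)] card inc rec own)
  then show ?thesis by blast
qed

end


section \<open>Parameters\<close>

text \<open>Lets an \<open>O(log n)\<close> bound absorb the factor \<open>log_star\<close>. The
  \<open>LEAST\<close> is meaningful once some iterate is shown to reach 1.\<close>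

lemma log_star_pos:
  assumes "x > 1"
  shows "log_star x \<ge> 1"
proof -
  have "\<exists>k. (log 2 ^^ k) y \<le> 1" if "y \<le> real (Suc N)" for y N
    using that
  proof (induction N arbitrary: y)
    case 0
    then show ?case by (intro exI[of _ 0]) simp
  next
    case (Suc N)
    show ?case
    proof (cases "y \<le> 1")
      case True
      then show ?thesis by (intro exI[of _ 0]) simp
    next
      case False
      \<comment> \<open>From \<open>Suc N < 2 ^ Suc N\<close>; each logarithm thus lowers the
        integer bound by at least one.\<close>
      have "y \<le> 2 ^ Suc N"
        using Suc.prems of_nat_mono[OF Suc_leI[OF less_exp[of "Suc N"]], where 'a = real] by simp
      then have "log 2 y \<le> real (Suc N)"
        using False by (subst log_le_iff) (auto simp: powr_realpow simp del: of_nat_Suc power_Suc)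
      then obtain k where "(log 2 ^^ k) (log 2 y) \<le> 1" using Suc.IH by blast
      then show ?thesis
        by (intro exI[of _ "Suc k"]) (simp add: funpow_swap1)
    qed
  qed
  moreover obtain N where "x \<le> real (Suc N)"
    using real_arch_simple[of x] by (metis lessI less_imp_le of_nat_less_iff order_trans)
  ultimately have "(log 2 ^^ log_star x) x \<le> 1"
    unfolding log_star_def by (metis (mono_tags, lifting) LeastI_ex)
  then have "log_star x \<noteq> 0" using assms by (metis funpow_0 not_le)
  then show ?thesis by simp
qed

definition num_bits :: "nat \<Rightarrow> nat" where
  "num_bits n = nat \<lceil>log 2 (real n)\<rceil>"

lemma le_two_power_num_bits: "n \<le> 2 ^ num_bits n"
proof (cases "n = 0")
  case False
  have "log 2 (real n) \<le> real (num_bits n)"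
    unfolding num_bits_def by linarith
  then have "real n \<le> 2 powr real (num_bits n)"
    using False by (simp add: log_le_iff)
  then have "real n \<le> real (2 ^ num_bits n)"
    by (simp add: powr_realpow)
  then show ?thesis by (simp only: of_nat_le_iff)
qed simp

text \<open>Rounding up adds less than 1, which is at most the logarithm itself.\<close>

lemma num_bits_le: "n \<ge> 2 \<Longrightarrow> real (num_bits n) \<le> 2 * log 2 (real n)"
proof -
  assume "n \<ge> 2"
  then have "log 2 (real n) \<ge> 1" by (simp add: le_log_iff)
  then show ?thesis unfolding num_bits_def by linarith
qed

text \<open>By counting: there are at most \<open>N ^ 2\<close> edges and \<open>2 ^ (2 * l)\<close>
  words.\<close>

lemma edge_code_exists:
  assumes "N \<le> 2 ^ l"
  shows "\<exists>f :: nat set \<Rightarrow> message.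
    inj_on f {e. e \<subseteq> {..<N} \<and> card e = 2} \<and> (\<forall>e. length (f e) \<le> 2 * l)"
proof -
  let ?S = "{e. e \<subseteq> {..<N} \<and> card e = 2}" and ?B = "{xs :: bool list. set xs \<subseteq> UNIV \<and> length xs = 2 * l}"
  have finS: "finite ?S" by (rule finite_subset[of _ "Pow {..<N}"]) auto
  have finB: "finite ?B" by (rule finite_lists_length_eq) simp
  have "card ?S \<le> card ?B"
  proof -
    have "card ?S = N choose 2"
      by (simp add: n_subsets)
    also have "\<dots> \<le> N ^ 2"
      by (cases "N < 2") (auto simp: binomial_eq_0 intro: binomial_le_pow)
    also have "\<dots> \<le> (2 ^ l) ^ 2"
      using assms by (rule power_mono) simp
    also have "\<dots> = card (UNIV :: bool set) ^ (2 * l)"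
      by (simp add: power_mult[symmetric] mult.commute)
    also have "\<dots> = card ?B"
      by (rule card_lists_length_eq[symmetric]) simp
    finally show ?thesis .
  qed
  from card_le_inj[OF finS finB this] obtain f where f: "f ` ?S \<subseteq> ?B" "inj_on f ?S"
    by (elim exE conjE)
  \<comment> \<open>The default \<open>[]\<close> makes the length bound hold for every
    argument.\<close>
  let ?f = "\<lambda>e. if e \<in> ?S then f e else []"
  have "inj_on ?f ?S"
    using f(2) by (simp add: inj_on_def)
  moreover have "length (?f e) \<le> 2 * l" for e
  proof (cases "e \<in> ?S")
    case True
    then have "f e \<in> ?B" using f(1) by blast
    then show ?thesis by simp
  next
    case False
    show ?thesis unfolding if_not_P[OF False] by simp
  qed
  ultimately show ?thesis by (intro exI[of _ ?f] conjI allI)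
qed

theorem theorem1p4:
  fixes c :: nat
  shows "\<exists>(A :: (nat \<times> nat) set cc_algorithm) (b :: nat) (T :: nat \<Rightarrow> nat).
    (\<lambda>n. real (T n)) \<in> O(\<lambda>n. log 2 (real n) * real (log_star (real n))) \<and>
    (\<forall>V E. eulerian_graph V E \<and> short_ids c V \<longrightarrow>
       respects_bandwidth A b V E (T (card V)) \<and>
       (\<exists>D. eulerian_orientation V E D \<and>
          (\<forall>v\<in>V. result A (cc_run A V E (T (card V)) v) = incident_arcs D v)))"
proof -
  define levels where "levels n = c * num_bits n" for n
  \<comment> \<open>Round 0, two rounds per level, and the final report.\<close>
  define T where "T n = 2 * levels n + 2" for n
  have levels: "n ^ c \<le> 2 ^ levels n" for n
    using power_mono[OF le_two_power_num_bits, of n c]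
    by (simp add: levels_def mult.commute flip: power_mult)
  obtain code :: "nat \<Rightarrow> nat set \<Rightarrow> message" where
    code: "inj_on (code n) {e. e \<subseteq> {..<n ^ c} \<and> card e = 2}" and
    code_length: "length (code n e) \<le> 2 * levels n" for n e
    using edge_code_exists[OF levels] by metis
  interpret protocol c levels code
    using levels code by unfold_locales
  define P where "P V E \<longleftrightarrow> valid V E \<and> eulerian_graph V E" for V E
  have P: "P V E \<longleftrightarrow> eulerian_graph V E \<and> short_ids c V" for V E
    by (auto simp: P_def valid_def eulerian_graph_def)
  have "\<exists>A :: (nat \<times> nat) set cc_algorithm. \<forall>V E. P V E \<longrightarrow>
    (\<forall>t. \<forall>v\<in>V. send A (cc_run A V E t v) = messages V E t v) \<and>
    (\<forall>v\<in>V. result A (cc_run A V E (T (card V)) v) = incident_arcs (solution V E) v)"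
  proof (rule schedule_realizable)
    show "messages V E t v = messages V' E' t v"
      if "P V E" "P V' E'" "v \<in> V" "v \<in> V'" "view messages V E t v = view messages V' E' t v"
      for V E V' E' t v
      using that by (intro indist_messages) (auto simp: P_def)
    show "incident_arcs (solution V E) v = incident_arcs (solution V' E') v"
      if "P V E" "P V' E'" "v \<in> V" "v \<in> V'"
        "view messages V E (T (card V)) v = view messages V' E' (T (card V)) v"
      for V E V' E' v
      using that by (intro indist_solution) (auto simp: P_def T_def)
  qed
  then obtain A :: "(nat \<times> nat) set cc_algorithm" where
    A: "\<forall>V E. P V E \<longrightarrow> (\<forall>t. \<forall>v\<in>V. send A (cc_run A V E t v) = messages V E t v) \<and>
      (\<forall>v\<in>V. result A (cc_run A V E (T (card V)) v) = incident_arcs (solution V E) v)"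
    by (elim exE)
  \<comment> \<open>A code word has at most \<open>2 * levels n\<close> bits; rounding in
    \<open>num_bits\<close> doubles this to \<open>4 * c\<close> logarithms.\<close>
  have bandwidth: "respects_bandwidth A (4 * c) V E (T (card V))" if "P V E" for V E
    unfolding respects_bandwidth_def
  proof (intro allI ballI impI)
    fix t u v m
    assume uv: "u \<in> V" "v \<in> V" "u \<noteq> v" and m: "send A (cc_run A V E t u) v = Some m"
    have "messages V E t u v = Some m" using m A that uv(1) by simp
    then have "length m \<le> 2 * levels (card V)"
      using code_length by (auto simp: messages_def Let_def split: if_splits)
    then have "real (length m) \<le> 2 * real c * real (num_bits (card V))"
      by (simp add: levels_def flip: of_nat_le_iff[where 'a = real])
    also have "finite V"
      using that by (simp add: P eulerian_graph_def simple_graph_def)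
    then have "card V \<ge> 2"
      using card_mono[of V "{u, v}"] uv by simp
    then have "2 * real c * real (num_bits (card V)) \<le> 2 * real c * (2 * log 2 (real (card V)))"
      using num_bits_le by (intro mult_left_mono) auto
    finally show "real (length m) \<le> real (4 * c) * log 2 (real (card V))" by simp
  qed
  have solution: "eulerian_orientation V E (solution V E)" if "P V E" for V E
    using eulerian_orientation_solution[of V E] that by (simp add: P_def eulerian_orientation_def)
  have "(\<lambda>n. real (T n)) \<in> O(\<lambda>n. log 2 (real n) * real (log_star (real n)))"
  \<comment> \<open>The levels contribute \<open>4 * c\<close> logarithms, and the two extra rounds
    at most two more.\<close>
  proof (rule bigoI[where c = "4 * c + 2"])
    have "norm (real (T n)) \<le> real (4 * c + 2) * norm (log 2 (real n) * real (log_star (real n)))"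
      if "n \<ge> 2" for n
    proof -
      have log: "1 \<le> log 2 (real n)" using that by (simp add: le_log_iff)
      have "real (T n) \<le> 2 * (real c * (2 * log 2 (real n))) + 2"
        using mult_left_mono[OF num_bits_le[OF that], of "real c"]
        by (simp add: T_def levels_def)
      also have "\<dots> \<le> real (4 * c + 2) * log 2 (real n)"
        using log by (simp add: algebra_simps)
      also have "\<dots> \<le> real (4 * c + 2) * (log 2 (real n) * real (log_star (real n)))"
        using log log_star_pos[of "real n"] that by (intro mult_left_mono) auto
      finally show ?thesis using log by (simp add: abs_mult)
    qed
    then show "\<forall>\<^sub>F n in sequentially. norm (real (T n)) \<le>
        real (4 * c + 2) * norm (log 2 (real n) * real (log_star (real n)))"
      unfolding eventually_at_top_linorder by blast
  qed
  moreover have "respects_bandwidth A (4 * c) V E (T (card V)) \<and>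
      (\<exists>D. eulerian_orientation V E D \<and>
        (\<forall>v\<in>V. result A (cc_run A V E (T (card V)) v) = incident_arcs D v))" if "P V E" for V E
    using that A by (intro conjI bandwidth exI[of _ "solution V E"] solution) auto
  ultimately show ?thesis
    unfolding P[symmetric]
    by (intro exI[of _ A] exI[of _ "4 * c"] exI[of _ T]) blast
qed

end
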